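(* Let $n=2k+1$ for some $k\in\mathbb{Z}$, and let $Q=(\mathbb{Z}_n,\circ)$, where $r\circ s=2s-r \bmod n$. Then $\mathrm{Mlt}_\rho(Q)\cong D_{2n}$, the dihedral group of order $2n$.
   Context: $\mathbb{Z}_n=\{0,1,\ldots,n-1\}$ denotes the integers modulo $n$. The groupoid $(\mathbb{Z}_n,\circ)$ is a quasigroup, i.e. for all $a,b$ the equations $a\circ x=b$ and $y\circ a=b$ have unique solutions $x,y$. For $x\in Q$ the right translation is the permutation $R_x: y\mapsto y\circ x$ of $Q$, and the right multiplication group is $\mathrm{Mlt}_\rho(Q)=\langle R_x \mid x\in Q\rangle$, a subgroup of the symmetric group on $Q$. The dihedral group is $D_{2n}=\langle x,y\mid x^n=y^2=(xy)^2=1\rangle$.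
   Formalization: The formal theorem assumes n ≥ 3: for n = 1 the claim fails, since Mlt_ρ(Q) is trivial while ⟨x,y | x = y² = (xy)² = 1⟩ has order 2, and for negative n the set {0,…,n−1} is not defined. *)

theory Defs
  imports "HOL-Algebra.Algebra"
begin

section \<open>Quasigroups and the right multiplication group\<close>

locale quasigroup =
  fixes Q :: "'a set" and op :: "'a \<Rightarrow> 'a \<Rightarrow> 'a"
  assumes closed: "\<lbrakk>a \<in> Q; b \<in> Q\<rbrakk> \<Longrightarrow> op a b \<in> Q"
    and right_solvable: "\<lbrakk>a \<in> Q; b \<in> Q\<rbrakk> \<Longrightarrow> \<exists>!x. x \<in> Q \<and> op a x = b"
    and left_solvable: "\<lbrakk>a \<in> Q; b \<in> Q\<rbrakk> \<Longrightarrow> \<exists>!y. y \<in> Q \<and> op y a = b"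

text \<open>Restricted to \<open>Q\<close>, because the elements of \<^const>\<open>BijGroup\<close> are extensional functions.\<close>

definition right_translation :: "'a set \<Rightarrow> ('a \<Rightarrow> 'a \<Rightarrow> 'a) \<Rightarrow> 'a \<Rightarrow> 'a \<Rightarrow> 'a" where
  "right_translation Q op x = (\<lambda>y\<in>Q. op y x)"

text \<open>
  \<^const>\<open>subgroup_generated\<close> silently discards generators outside the carrier. In a quasigroup
  nothing is discarded, by \<open>right_translation_Bij\<close> below.
\<close>

definition Mlt_right :: "'a set \<Rightarrow> ('a \<Rightarrow> 'a \<Rightarrow> 'a) \<Rightarrow> ('a \<Rightarrow> 'a) monoid" where
  "Mlt_right Q op = subgroup_generated (BijGroup Q) (right_translation Q op ` Q)"

lemma (in quasigroup) right_translation_Bij: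
  assumes "x \<in> Q"
  shows "right_translation Q op x \<in> carrier (BijGroup Q)"
proof -
  have "inj_on (\<lambda>y. op y x) Q"
    using left_solvable[OF assms] closed[OF _ assms] by (auto simp: inj_on_def)
  moreover have "(\<lambda>y. op y x) ` Q = Q"
    using left_solvable[OF assms] closed[OF _ assms] by (auto simp: image_iff) metis
  ultimately have "bij_betw (\<lambda>y. op y x) Q Q"
    by (simp add: bij_betw_def)
  then show ?thesis
    by (simp add: BijGroup_def Bij_def right_translation_def)
qed

definition dihedral_quandle_op :: "int \<Rightarrow> int \<Rightarrow> int \<Rightarrow> int" where
  "dihedral_quandle_op n r s = (2 * s - r) mod n"

lemma mod_eq_imp_eq:
  fixes n x y :: int
  assumes "0 \<le> x" "x < n" "0 \<le> y" "y < n" "n dvd x - y"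
  shows "x = y"
  using assms by (metis mod_eq_dvd_iff mod_pos_pos_trivial)

lemma quasigroup_dihedral_quandle_op:
  assumes "n > 0" and "odd n"
  shows "quasigroup {0..<n} (dihedral_quandle_op n)"
proof
  show "dihedral_quandle_op n a b \<in> {0..<n}" for a b
    using assms by (simp add: dihedral_quandle_op_def)
next
  fix a b assume ab: "a \<in> {0..<n}" "b \<in> {0..<n}"
  obtain k where k: "n = 2 * k + 1"
    using \<open>odd n\<close> by (auto elim: oddE)
  show "\<exists>!x. x \<in> {0..<n} \<and> dihedral_quandle_op n a x = b"
  proof (rule ex1I)
    let ?x = "((k + 1) * (a + b)) mod n"
    have "(2 * ?x - a) mod n = (2 * ((k + 1) * (a + b)) - a) mod n"
      by (metis mod_diff_left_eq mod_mult_right_eq)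
    also have "2 * ((k + 1) * (a + b)) - a = b + n * (a + b)"
      by (simp add: k algebra_simps)
    finally show "?x \<in> {0..<n} \<and> dihedral_quandle_op n a ?x = b"
      using ab assms by (simp add: dihedral_quandle_op_def)
    fix x assume x: "x \<in> {0..<n} \<and> dihedral_quandle_op n a x = b"
    then have "(2 * x - a) mod n = (2 * ?x - a) mod n"
      using \<open>?x \<in> {0..<n} \<and> dihedral_quandle_op n a ?x = b\<close>
      by (simp add: dihedral_quandle_op_def)
    then have "n dvd 2 * (x - ?x)"
      by (simp add: mod_eq_dvd_iff algebra_simps)
    then have "n dvd x - ?x"
      using \<open>odd n\<close> by (metis coprime_dvd_mult_right_iff coprime_right_2_iff_odd)
    then show "x = ?x"
      using x assms(1) by (intro mod_eq_imp_eq[of _ n]) auto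
  qed
  show "\<exists>!y. y \<in> {0..<n} \<and> dihedral_quandle_op n y a = b"
  proof (rule ex1I)
    let ?y = "(2 * a - b) mod n"
    show "?y \<in> {0..<n} \<and> dihedral_quandle_op n ?y a = b"
      using ab assms by (simp add: dihedral_quandle_op_def mod_diff_right_eq)
    fix y assume y: "y \<in> {0..<n} \<and> dihedral_quandle_op n y a = b"
    then have "(2 * a - b) mod n = y mod n"
      by (auto simp: dihedral_quandle_op_def mod_diff_right_eq)
    then show "y = ?y"
      using y by simp
  qed
qed


section \<open>Groups given by generators and relators\<close>

text \<open>
  The group with generating set \<open>UNIV :: 'a set\<close> and relator set \<open>R\<close>. Words are lists of signed
  letters, where \<open>(g, True)\<close> stands for \<open>g\<close> and \<open>(g, False)\<close> for its inverse. The group consists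
  of the words modulo the least congruence that cancels adjacent inverse letters and kills the
  relators, i.e. it is the free group modulo the normal closure of \<open>R\<close>.
\<close>

type_synonym 'a word = "('a \<times> bool) list"

inductive word_cong :: "'a word set \<Rightarrow> 'a word \<Rightarrow> 'a word \<Rightarrow> bool" for R where
  refl: "word_cong R u u"
| sym: "word_cong R u v \<Longrightarrow> word_cong R v u"
| trans: "word_cong R u v \<Longrightarrow> word_cong R v w \<Longrightarrow> word_cong R u w"
| append: "word_cong R u u' \<Longrightarrow> word_cong R v v' \<Longrightarrow> word_cong R (u @ v) (u' @ v')"
| cancel: "word_cong R [(g, e), (g, \<not> e)] []"
| relator: "r \<in> R \<Longrightarrow> word_cong R r []"

definition word_class :: "'a word set \<Rightarrow> 'a word \<Rightarrow> 'a word set" where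
  "word_class R u = {v. word_cong R u v}"

definition presented_group :: "'a word set \<Rightarrow> 'a word set monoid" where
  "presented_group R =
    \<lparr>carrier = range (word_class R),
     monoid.mult = (\<lambda>A B. \<Union>u\<in>A. \<Union>v\<in>B. word_class R (u @ v)),
     one = word_class R []\<rparr>"

lemma word_class_eq_iff: "word_class R u = word_class R v \<longleftrightarrow> word_cong R u v"
  unfolding word_class_def
  by (auto simp: set_eq_iff intro: word_cong.refl) (blast intro: word_cong.sym word_cong.trans)+

lemma word_class_mult:
  "word_class R u \<otimes>\<^bsub>presented_group R\<^esub> word_class R v = word_class R (u @ v)"
proof -
  have "word_class R (u' @ v') = word_class R (u @ v)"
    if "u' \<in> word_class R u" "v' \<in> word_class R v" for u' v'
    unfolding word_class_eq_iff
    using that by (simp add: word_class_def word_cong.append word_cong.sym)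
  moreover have "u \<in> word_class R u" "v \<in> word_class R v"
    by (auto simp: word_class_def word_cong.refl)
  ultimately have "(\<Union>u'\<in>word_class R u. \<Union>v'\<in>word_class R v. word_class R (u' @ v'))
      = word_class R (u @ v)"
    by blast
  then show ?thesis
    by (simp add: presented_group_def)
qed

lemma word_cong_inverse:
  "word_cong R (map (\<lambda>(g, e). (g, \<not> e)) (rev u) @ u) []"
proof (induction u)
  case Nil
  show ?case by (simp add: word_cong.refl)
next
  case (Cons a u)
  obtain g e where a: "a = (g, e)" by force
  let ?w = "map (\<lambda>(g, e). (g, \<not> e)) (rev u)"
  have "word_cong R (?w @ ([(g, \<not> e), (g, e)] @ u)) (?w @ ([] @ u))"
    using word_cong.cancel[of R g "\<not> e"] by (intro word_cong.append word_cong.refl) simp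
  from word_cong.trans[OF this] Cons show ?case
    by (simp add: a)
qed

lemma group_presented_group: "group (presented_group R)"
proof (rule groupI)
  have carrier: "carrier (presented_group R) = range (word_class R)"
    and one: "\<one>\<^bsub>presented_group R\<^esub> = word_class R []"
    by (simp_all add: presented_group_def)
  show "A \<otimes>\<^bsub>presented_group R\<^esub> B \<in> carrier (presented_group R)"
    if "A \<in> carrier (presented_group R)" "B \<in> carrier (presented_group R)" for A B
    using that by (auto simp: carrier word_class_mult)
  show "\<one>\<^bsub>presented_group R\<^esub> \<in> carrier (presented_group R)"
    by (simp add: carrier one)
  show "A \<otimes>\<^bsub>presented_group R\<^esub> B \<otimes>\<^bsub>presented_group R\<^esub> C
      = A \<otimes>\<^bsub>presented_group R\<^esub> (B \<otimes>\<^bsub>presented_group R\<^esub> C)"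
    if "A \<in> carrier (presented_group R)" "B \<in> carrier (presented_group R)"
      "C \<in> carrier (presented_group R)" for A B C
    using that by (auto simp: carrier word_class_mult)
  show "\<one>\<^bsub>presented_group R\<^esub> \<otimes>\<^bsub>presented_group R\<^esub> A = A"
    if "A \<in> carrier (presented_group R)" for A
    using that by (auto simp: carrier one word_class_mult)
  show "\<exists>B\<in>carrier (presented_group R). B \<otimes>\<^bsub>presented_group R\<^esub> A = \<one>\<^bsub>presented_group R\<^esub>"
    if A: "A \<in> carrier (presented_group R)" for A
  proof -
    obtain u where u: "A = word_class R u"
      using A by (auto simp: carrier)
    show ?thesis
      by (rule bexI[of _ "word_class R (map (\<lambda>(g, e). (g, \<not> e)) (rev u))"])
        (auto simp: u carrier one word_class_mult word_class_eq_iff word_cong_inverse)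
  qed
qed

primrec word_eval :: "('b, 'c) monoid_scheme \<Rightarrow> ('a \<Rightarrow> 'b) \<Rightarrow> 'a word \<Rightarrow> 'b" where
  "word_eval G f [] = \<one>\<^bsub>G\<^esub>"
| "word_eval G f (a # u) =
    (if snd a then f (fst a) else inv\<^bsub>G\<^esub> f (fst a)) \<otimes>\<^bsub>G\<^esub> word_eval G f u"

lemma (in group) word_eval_closed:
  "(\<And>g. f g \<in> carrier G) \<Longrightarrow> word_eval G f u \<in> carrier G"
  by (induction u) auto

lemma (in group) word_eval_append:
  "(\<And>g. f g \<in> carrier G) \<Longrightarrow> word_eval G f (u @ v) = word_eval G f u \<otimes> word_eval G f v"
  by (induction u) (auto simp: word_eval_closed m_assoc)

lemma (in group) word_eval_cong:
  assumes "word_cong R u v" and f: "\<And>g. f g \<in> carrier G"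
    and "\<And>r. r \<in> R \<Longrightarrow> word_eval G f r = \<one>"
  shows "word_eval G f u = word_eval G f v"
  using assms(1) by induction (auto simp: word_eval_append f assms(3))

text \<open>The universal property (von Dyck), which characterises the presented group.\<close>

lemma (in group) presented_group_universal:
  assumes f: "\<And>g. f g \<in> carrier G" and "\<And>r. r \<in> R \<Longrightarrow> word_eval G f r = \<one>"
  shows "\<exists>h \<in> hom (presented_group R) G. \<forall>g. h (word_class R [(g, True)]) = f g"
proof -
  define h where "h A = word_eval G f (SOME u. u \<in> A)" for A
  have h: "h (word_class R u) = word_eval G f u" for u
  proof -
    have "(SOME v. v \<in> word_class R u) \<in> word_class R u"
      by (rule someI[of _ u]) (simp add: word_class_def word_cong.refl)
    then have "word_cong R u (SOME v. v \<in> word_class R u)"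
      by (simp add: word_class_def)
    then show ?thesis
      unfolding h_def using assms by (metis word_eval_cong)
  qed
  have carrier: "carrier (presented_group R) = range (word_class R)"
    by (simp add: presented_group_def)
  have "h \<in> hom (presented_group R) G"
    by (rule homI) (auto simp: carrier h word_class_mult word_eval_closed word_eval_append f)
  moreover have "h (word_class R [(g, True)]) = f g" for g
    by (simp add: h f)
  ultimately show ?thesis
    by blast
qed


section \<open>The dihedral group\<close>

datatype dihedral_gen = Gen_x | Gen_y

definition dihedral_group :: "nat \<Rightarrow> dihedral_gen word set monoid" where
  "dihedral_group n = presented_group
    {replicate n (Gen_x, True),
     [(Gen_y, True), (Gen_y, True)],
     [(Gen_x, True), (Gen_y, True), (Gen_x, True), (Gen_y, True)]}"

end

theory Submission
  imports Defs
begin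

text \<open>
  The right translation by \<open>s\<close> is the reflection \<open>z \<mapsto> 2s - z\<close> of \<open>\<int>\<^sub>n\<close>. As \<open>n = 2k + 1\<close>, the
  number \<open>k + 1\<close> is an inverse of \<open>2\<close>, so every reflection \<open>z \<mapsto> c - z\<close> is a right translation,
  and the product of two reflections is an arbitrary rotation. The right multiplication group is
  therefore the group of all maps \<open>z \<mapsto> \<plusminus>z + c\<close> (\<open>carrier_Mlt_right_dihedral\<close>).

  The rotation \<open>z \<mapsto> z + 1\<close> and the reflection \<open>z \<mapsto> -z\<close> satisfy the dihedral relations, so von
  Dyck's theorem provides a homomorphism from the presented group into the permutations of \<open>\<int>\<^sub>n\<close>.
  The relations bring every word into one of the \<open>2n\<close> forms \<open>x\<^sup>i y\<^sup>j\<close> with \<open>i < n\<close> and \<open>j < 2\<close>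
  (\<open>dihedral_normal_form\<close>), and that form is sent to \<open>z \<mapsto> (-1)\<^sup>j z + i\<close>. For \<open>n \<ge> 3\<close> these \<open>2n\<close>
  maps are distinct: \<open>0\<close> goes to \<open>i\<close>, and the sign is determined because \<open>1\<close> and \<open>-1\<close> differ
  modulo \<open>n\<close>. So the normal forms are distinct as well, which gives the order \<open>2n\<close>, and the
  homomorphism is a bijection onto the maps \<open>z \<mapsto> \<plusminus>z + c\<close>.
\<close>


section \<open>Normal forms for the dihedral relations\<close>

lemma (in group) dihedral_conj_pow:
  assumes "a \<in> carrier G" "b \<in> carrier G" and ba: "b \<otimes> a = inv a \<otimes> b"
  shows "b \<otimes> a [^] (i::nat) = inv a [^] i \<otimes> b"
proof (induction i)
  case (Suc i)
  have "b \<otimes> a [^] Suc i = (b \<otimes> a [^] i) \<otimes> a"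
    using assms by (simp add: m_assoc)
  also have "\<dots> = inv a [^] i \<otimes> (b \<otimes> a)"
    using assms by (simp add: Suc m_assoc)
  also have "\<dots> = inv a [^] Suc i \<otimes> b"
    using assms by (simp add: m_assoc)
  finally show ?case .
qed (use assms in simp)

text \<open>
  The set of elements \<open>a\<^sup>i b\<^sup>j\<close> contains the unit and is stable under left multiplication by every
  signed generator: the relations give \<open>ba = a\<^sup>-\<^sup>1b\<close>, so \<open>b\<close> can be moved past \<open>a\<^sup>i\<close>.
  Reducing \<open>i\<close> modulo \<open>n\<close> lets \<open>a\<^sup>-\<^sup>1 = a\<^sup>n\<^sup>-\<^sup>1\<close> play the role of a positive power.
\<close>

lemma (in group) dihedral_normal_form:
  fixes n :: nat
  assumes f: "\<And>g. f g \<in> carrier G" and n: "n > 0"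
    and an: "f Gen_x [^] n = \<one>" and bb: "f Gen_y \<otimes> f Gen_y = \<one>"
    and abab: "f Gen_x \<otimes> (f Gen_y \<otimes> (f Gen_x \<otimes> f Gen_y)) = \<one>"
  shows "\<exists>i<n. \<exists>j<2. word_eval G f u = f Gen_x [^] i \<otimes> f Gen_y [^] (j::nat)"
proof (induction u)
  case Nil
  show ?case using n f by (intro exI[of _ "0::nat"] conjI) auto
next
  case (Cons s u)
  define a b where "a = f Gen_x" and "b = f Gen_y"
  have a: "a \<in> carrier G" and b: "b \<in> carrier G"
    by (simp_all add: a_def b_def f)
  note an = an[folded a_def] and bb = bb[folded b_def] and abab = abab[folded a_def b_def]
  have inv_b: "inv b = b"
    using bb b by (simp add: inv_equality)
  have inv_a: "inv a = a [^] (n - 1)"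
  proof (rule inv_equality)
    show "a [^] (n - 1) \<otimes> a = \<one>"
      using an n a by (metis Suc_pred' nat_pow_Suc)
  qed (use a in auto)
  have ba: "b \<otimes> a = inv a \<otimes> b"
  proof -
    have "inv a = b \<otimes> (a \<otimes> b)"
      using abab a b by (metis inv_char inv_comm m_closed)
    then show ?thesis
      using a b bb by (simp add: m_assoc)
  qed
  have reduce: "a [^] m = a [^] (m mod n)" for m :: nat
    using a an by (metis div_mult_mod_eq mult.commute nat_pow_closed nat_pow_mult nat_pow_one
        nat_pow_pow l_one)
  obtain i j where ij: "i < n" "j < 2" "word_eval G f u = a [^] i \<otimes> b [^] (j::nat)"
    using Cons.IH by (auto simp: a_def b_def)
  have a_case: "\<exists>i'<n. \<exists>j'<2. a [^] m \<otimes> (a [^] i \<otimes> b [^] j) = a [^] i' \<otimes> b [^] (j'::nat)" for m :: nat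
    using a b n ij reduce[of "m + i"]
    by (intro exI[of _ "(m + i) mod n"] conjI exI[of _ j]) (auto simp flip: m_assoc simp: nat_pow_mult)
  have b_case: "\<exists>i'<n. \<exists>j'<2. b \<otimes> (a [^] i \<otimes> b [^] j) = a [^] i' \<otimes> b [^] (j'::nat)"
  proof (intro exI conjI)
    have "b \<otimes> b [^] j = b [^] (1 - j)"
      using ij(2) b bb by (auto simp: less_2_cases_iff)
    then have "b \<otimes> (a [^] i \<otimes> b [^] j) = inv a [^] i \<otimes> b [^] (1 - j)"
      using a b dihedral_conj_pow[OF a b ba, of i] by (metis inv_closed m_assoc nat_pow_closed)
    then show "b \<otimes> (a [^] i \<otimes> b [^] j) = a [^] (((n - 1) * i) mod n) \<otimes> b [^] (1 - j)"
      using a by (simp add: inv_a nat_pow_pow flip: reduce)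
  qed (use n in auto)
  obtain g e where s: "s = (g, e)" by force
  show ?case
  proof (cases g)
    case Gen_x
    then show ?thesis
      using a_case[of 1] a_case[of "n - 1"] a inv_a ij(3)
      by (cases e) (simp_all add: s flip: a_def b_def)
  next
    case Gen_y
    then show ?thesis
      using b_case inv_b ij(3) by (cases e) (simp_all add: s flip: a_def b_def)
  qed
qed

text \<open>
  This turns congruence of words into a computation in the presented group, to which statements
  about \<^const>\<open>word_eval\<close> in arbitrary groups, such as the normal form, apply.
\<close>

lemma word_class_eq_word_eval:
  "word_class R u = word_eval (presented_group R) (\<lambda>g. word_class R [(g, True)]) u"
proof (induction u)
  case Nil
  show ?case by (simp add: presented_group_def)
next
  case (Cons s u)
  interpret P: group "presented_group R" by (rule group_presented_group)
  have carrier: "word_class R v \<in> carrier (presented_group R)" for v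
    by (simp add: presented_group_def)
  have one: "\<one>\<^bsub>presented_group R\<^esub> = word_class R []"
    by (simp add: presented_group_def)
  obtain g e where s: "s = (g, e)" by force
  have "inv\<^bsub>presented_group R\<^esub> word_class R [(g, True)] = word_class R [(g, False)]"
    by (rule P.inv_equality)
      (use word_cong.cancel[of R g False] in
        \<open>simp_all add: carrier one word_class_mult word_class_eq_iff\<close>)
  then have "(if e then word_class R [(g, True)]
      else inv\<^bsub>presented_group R\<^esub> word_class R [(g, True)]) = word_class R [s]"
    by (simp add: s)
  moreover have "word_class R (s # u)
      = word_class R [s] \<otimes>\<^bsub>presented_group R\<^esub> word_class R u"
    by (simp add: word_class_mult)
  ultimately show ?case
    by (simp only: Cons.IH s word_eval.simps fst_conv snd_conv)
qed

lemma (in group) word_eval_replicate: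
  assumes "f g \<in> carrier G"
  shows "word_eval G f (replicate m (g, True)) = f g [^] m"
proof (induction m)
  case (Suc m)
  then show ?case using assms nat_pow_Suc2[of "f g" m] by simp
qed simp

text \<open>
  Both conclusions rest on the hypothesis that the words \<open>a\<^sup>i b\<^sup>j\<close> are distinct in \<open>G\<close>: then they
  are also distinct in the presented group, where they exhaust the elements.
\<close>

lemma (in group) dihedral_group_recognition:
  fixes n :: nat
  assumes a: "a \<in> carrier G" and b: "b \<in> carrier G" and n: "n > 0"
    and an: "a [^] n = \<one>" and bb: "b \<otimes> b = \<one>" and abab: "a \<otimes> (b \<otimes> (a \<otimes> b)) = \<one>"
    and inj: "inj_on (\<lambda>(i, j). a [^] i \<otimes> b [^] j) ({..<n} \<times> {..<2::nat})"
  shows "dihedral_group n \<cong> G\<lparr>carrier := (\<lambda>(i, j). a [^] i \<otimes> b [^] j) ` ({..<n} \<times> {..<2::nat})\<rparr>"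
    and "order (dihedral_group n) = 2 * n"
proof -
  let ?R = "{replicate n (Gen_x, True), [(Gen_y, True), (Gen_y, True)],
     [(Gen_x, True), (Gen_y, True), (Gen_x, True), (Gen_y, True)]}"
  let ?N = "{..<n} \<times> {..<2::nat}"
  define D where "D = dihedral_group n"
  have D: "D = presented_group ?R"
    by (simp add: D_def dihedral_group_def)
  interpret D: group D
    unfolding D by (rule group_presented_group)
  define f where "f g = (case g of Gen_x \<Rightarrow> a | Gen_y \<Rightarrow> b)" for g
  have f: "f g \<in> carrier G" for g
    using a b by (simp add: f_def split: dihedral_gen.split)
  define gen where "gen g = word_class ?R [(g, True)]" for g
  have gen: "gen g \<in> carrier D" for g
    by (simp add: gen_def D presented_group_def)
  have "word_eval G f r = \<one>" if "r \<in> ?R" for r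
    using that an bb abab b word_eval_replicate[of f Gen_x n] f[of Gen_x] by (auto simp: f_def)
  then obtain h where h: "h \<in> hom D G" and h_gen: "\<And>g. h (gen g) = f g"
    unfolding D gen_def using presented_group_universal[of f ?R] f by blast
  interpret h: group_hom D G h
    using h by unfold_locales
  have word_class: "word_class ?R u = word_eval D gen u" for u
    unfolding D gen_def by (rule word_class_eq_word_eval)
  have relator: "word_eval D gen r = \<one>\<^bsub>D\<^esub>" if "r \<in> ?R" for r
  proof -
    have "word_class ?R r = word_class ?R []"
      using that by (simp only: word_class_eq_iff word_cong.relator)
    then show ?thesis
      by (simp only: word_class word_eval.simps)
  qed
  define nf where "nf = (\<lambda>(i, j). gen Gen_x [^]\<^bsub>D\<^esub> (i::nat) \<otimes>\<^bsub>D\<^esub> gen Gen_y [^]\<^bsub>D\<^esub> (j::nat))"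
  have "\<exists>i<n. \<exists>j<2. word_eval D gen u = gen Gen_x [^]\<^bsub>D\<^esub> i \<otimes>\<^bsub>D\<^esub> gen Gen_y [^]\<^bsub>D\<^esub> (j::nat)" for u
  proof (rule D.dihedral_normal_form[OF gen n])
    show "gen Gen_x [^]\<^bsub>D\<^esub> n = \<one>\<^bsub>D\<^esub>"
      using relator[of "replicate n (Gen_x, True)"] gen by (simp add: D.word_eval_replicate)
    show "gen Gen_y \<otimes>\<^bsub>D\<^esub> gen Gen_y = \<one>\<^bsub>D\<^esub>"
      using relator[of "[(Gen_y, True), (Gen_y, True)]"] gen by simp
    show "gen Gen_x \<otimes>\<^bsub>D\<^esub> (gen Gen_y \<otimes>\<^bsub>D\<^esub> (gen Gen_x \<otimes>\<^bsub>D\<^esub> gen Gen_y)) = \<one>\<^bsub>D\<^esub>"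
      using relator[of "[(Gen_x, True), (Gen_y, True), (Gen_x, True), (Gen_y, True)]"] gen
      by simp
  qed
  then have "word_class ?R u \<in> nf ` ?N" for u
    unfolding word_class nf_def by force
  then have "carrier D \<subseteq> nf ` ?N"
    unfolding D presented_group_def partial_object.simps by (rule image_subsetI)
  moreover have "nf ` ?N \<subseteq> carrier D"
    using gen by (auto simp: nf_def)
  ultimately have carrier: "carrier D = nf ` ?N"
    by (rule equalityI)
  have h_nf: "h (nf p) = (\<lambda>(i, j). a [^] i \<otimes> b [^] j) p" for p
    using gen by (cases p) (simp add: nf_def h.hom_nat_pow h_gen f_def)
  have inj_h: "inj_on (h \<circ> nf) ?N"
    using inj by (simp add: h_nf comp_def)
  have "inj_on nf ?N"
    using inj_h by (rule inj_on_imageI2)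
  then show "order (dihedral_group n) = 2 * n"
    unfolding D_def[symmetric] order_def carrier by (simp add: card_image)
  have "inj_on h (carrier D)"
    unfolding carrier using inj_h by (rule inj_on_imageI)
  moreover have "h ` carrier D = (\<lambda>(i, j). a [^] i \<otimes> b [^] j) ` ?N"
    unfolding carrier by (simp only: image_image h_nf)
  ultimately have "h \<in> iso D (G\<lparr>carrier := (\<lambda>(i, j). a [^] i \<otimes> b [^] j) ` ?N\<rparr>)"
    using h by (auto simp: iso_def hom_def bij_betw_def)
  then show "dihedral_group n \<cong> G\<lparr>carrier := (\<lambda>(i, j). a [^] i \<otimes> b [^] j) ` ?N\<rparr>"
    unfolding D_def is_iso_def by blast
qed


section \<open>The affine maps with multiplier 1 or -1\<close>

definition signed_shift :: "int \<Rightarrow> int \<Rightarrow> int \<Rightarrow> int \<Rightarrow> int" where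
  "signed_shift n e c = (\<lambda>z\<in>{0..<n}. (e * z + c) mod n)"

lemma signed_shift_compose:
  assumes "n > 0"
  shows "compose {0..<n} (signed_shift n e c) (signed_shift n e' c')
    = signed_shift n (e * e') (e * c' + c)"
proof -
  have "(e * ((e' * z + c') mod n) + c) mod n = (e * (e' * z + c') + c) mod n" for z
    by (metis mod_add_left_eq mod_mult_right_eq)
  then show ?thesis
    using assms by (auto simp: compose_def signed_shift_def restrict_def algebra_simps)
qed

lemma signed_shift_mod: "signed_shift n e (c mod n) = signed_shift n e c"
  by (simp add: signed_shift_def mod_add_right_eq)

lemma one_BijGroup_eq_signed_shift: "\<one>\<^bsub>BijGroup {0..<n}\<^esub> = signed_shift n 1 0"
  by (auto simp: BijGroup_def signed_shift_def restrict_def)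

text \<open>A square root \<open>e\<close> of \<open>1\<close> is its own inverse, so \<open>z \<mapsto> ez - ec\<close> undoes \<open>z \<mapsto> ez + c\<close>.\<close>

lemma signed_shift_in_BijGroup:
  assumes "n > 0" "e * e = 1"
  shows "signed_shift n e c \<in> carrier (BijGroup {0..<n})"
proof -
  have undo: "signed_shift n e c (signed_shift n e d z) = z"
    if "e * d + c = 0" "z \<in> {0..<n}" for c d z
    using fun_cong[OF signed_shift_compose[OF assms(1), of e c e d], of z] that assms
    by (simp add: compose_def) (simp add: signed_shift_def)
  have "bij_betw (signed_shift n e c) {0..<n} {0..<n}"
  proof (rule bij_betw_byWitness[where f' = "signed_shift n e (- (e * c))"])
    have "e * (- (e * c)) + c = 0"
      using assms(2) by (simp flip: mult.assoc)
    then show "\<forall>z\<in>{0..<n}. signed_shift n e c (signed_shift n e (- (e * c)) z) = z"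
      by (simp add: undo)
    show "\<forall>z\<in>{0..<n}. signed_shift n e (- (e * c)) (signed_shift n e c z) = z"
      by (simp add: undo)
  qed (use assms(1) in \<open>auto simp: signed_shift_def\<close>)
  then show ?thesis
    by (simp add: BijGroup_def Bij_def) (simp add: signed_shift_def)
qed

lemma signed_shift_mult:
  assumes "n > 0" "e * e = 1" "e' * e' = 1"
  shows "signed_shift n e c \<otimes>\<^bsub>BijGroup {0..<n}\<^esub> signed_shift n e' c'
    = signed_shift n (e * e') (e * c' + c)"
  using signed_shift_in_BijGroup[OF assms(1,2), of c] signed_shift_in_BijGroup[OF assms(1,3), of c']
    signed_shift_compose[OF assms(1)]
  by (simp add: BijGroup_def)

lemma signed_shift_pow_rotation:
  assumes "n > 0"
  shows "signed_shift n 1 1 [^]\<^bsub>BijGroup {0..<n}\<^esub> (i::nat) = signed_shift n 1 (int i)"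
proof -
  interpret B: group "BijGroup {0..<n}" by (rule group_BijGroup)
  show ?thesis
    using assms by (induction i) (simp_all add: one_BijGroup_eq_signed_shift signed_shift_mult)
qed

lemma signed_shift_normal_form:
  assumes "n > 0" "j < 2"
  shows "signed_shift n 1 1 [^]\<^bsub>BijGroup {0..<n}\<^esub> i
      \<otimes>\<^bsub>BijGroup {0..<n}\<^esub> signed_shift n (- 1) 0 [^]\<^bsub>BijGroup {0..<n}\<^esub> j
    = signed_shift n ((- 1) ^ j) (int i)"
proof -
  interpret B: group "BijGroup {0..<n}" by (rule group_BijGroup)
  have "signed_shift n (- 1) 0 [^]\<^bsub>BijGroup {0..<n}\<^esub> j = signed_shift n ((- 1) ^ j) 0"
    using assms signed_shift_in_BijGroup[of n "- 1" 0]
    by (auto simp: less_2_cases_iff one_BijGroup_eq_signed_shift signed_shift_mult)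
  then show ?thesis
    using assms by (simp add: signed_shift_pow_rotation signed_shift_mult flip: power_mult_distrib)
qed

lemma signed_shift_inject:
  assumes "n \<ge> 3" "e \<in> {1, - 1}" "e' \<in> {1, - 1}" "c \<in> {0..<n}" "c' \<in> {0..<n}"
    and eq: "signed_shift n e c = signed_shift n e' c'"
  shows "e = e' \<and> c = c'"
proof -
  have c: "c = c'"
    using fun_cong[OF eq, of 0] assms by (simp add: signed_shift_def)
  have "(e + c) mod n = (e' + c) mod n"
    using fun_cong[OF eq, of 1] assms c by (simp add: signed_shift_def)
  then have "n dvd e - e'"
    by (simp add: mod_eq_dvd_iff)
  \<comment> \<open>\<open>e - e'\<close> is \<open>0\<close>, \<open>2\<close> or \<open>-2\<close>, and \<open>n\<close> exceeds \<open>2\<close>.\<close>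
  then have "e = e'"
    using assms(1-3) zdvd_imp_le[of n 2] by auto
  with c show ?thesis by simp
qed


section \<open>The right multiplication group of the dihedral quandle\<close>

lemma right_translation_dihedral:
  "right_translation {0..<n} (dihedral_quandle_op n) s = signed_shift n (- 1) (2 * s)"
  by (simp add: right_translation_def dihedral_quandle_op_def signed_shift_def)

text \<open>
  The reflection \<open>z \<mapsto> c - z\<close> is the right translation by \<open>(k + 1) c\<close>, half of \<open>c\<close> modulo \<open>n\<close>;
  the rotation by \<open>c\<close> is the reflection \<open>z \<mapsto> -z\<close> followed by \<open>z \<mapsto> c - z\<close>.
\<close>

lemma carrier_Mlt_right_dihedral:
  fixes n :: int
  assumes n: "n = 2 * k + 1" "n > 0"
  shows "carrier (Mlt_right {0..<n} (dihedral_quandle_op n))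
    = (\<lambda>(i, j). signed_shift n ((- 1) ^ j) (int i)) ` ({..<nat n} \<times> {..<2::nat})"
    (is "_ = ?S")
proof
  let ?B = "BijGroup {0..<n}"
  let ?T = "right_translation {0..<n} (dihedral_quandle_op n) ` {0..<n}"
  interpret B: group ?B by (rule group_BijGroup)
  \<comment> \<open>Indexed by signs and arbitrary integer shifts, closure under products and inverses is immediate.\<close>
  have S_iff: "?S = {signed_shift n e c | e c. e \<in> {1, - 1}}" (is "_ = ?S'")
  proof
    have "(- 1 :: int) ^ j \<in> {1, - 1}" for j
      by (induction j) auto
    then show "?S \<subseteq> ?S'"
      by fast
    show "?S' \<subseteq> ?S"
    proof
      fix g assume "g \<in> ?S'"
      then obtain e c where e: "e \<in> {1, - 1}" and g: "g = signed_shift n e c" by blast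
      then obtain j :: nat where j: "j < 2" "e = (- 1) ^ j"
        by (metis empty_iff insert_iff one_less_numeral_iff pos2 power_0 power_one_right
            semiring_norm(76))
      have "g = signed_shift n ((- 1) ^ j) (int (nat (c mod n)))"
        using n(2) by (simp add: g j signed_shift_mod)
      then show "g \<in> ?S"
        using j n(2) by (intro image_eqI[of _ _ "(nat (c mod n), j)"]) (auto simp: nat_less_iff)
    qed
  qed
  have T: "?T \<subseteq> carrier ?B"
    using n(2) by (auto simp: right_translation_dihedral signed_shift_in_BijGroup)
  then have carrier: "carrier (Mlt_right {0..<n} (dihedral_quandle_op n)) = generate ?B ?T"
    by (simp add: Mlt_right_def carrier_subgroup_generated Int_absorb1)
  have "subgroup ?S' ?B"
  proof (rule B.subgroupI)
    show "?S' \<subseteq> carrier ?B"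
      using n(2) by (auto simp: signed_shift_in_BijGroup)
    show "?S' \<noteq> {}" by blast
    show "g \<otimes>\<^bsub>?B\<^esub> h \<in> ?S'" if "g \<in> ?S'" "h \<in> ?S'" for g h
    proof -
      obtain d c where d: "d \<in> {1, - 1}" and g: "g = signed_shift n d c"
        using \<open>g \<in> ?S'\<close> by blast
      obtain e c' where e: "e \<in> {1, - 1}" and h: "h = signed_shift n e c'"
        using \<open>h \<in> ?S'\<close> by blast
      have "g \<otimes>\<^bsub>?B\<^esub> h = signed_shift n (d * e) (d * c' + c)"
        unfolding g h using d e n(2) by (intro signed_shift_mult) auto
      moreover have "d * e \<in> {1, - 1}"
        using d e by auto
      ultimately show ?thesis
        by (intro CollectI exI conjI)
    qed
    show "inv\<^bsub>?B\<^esub> g \<in> ?S'" if "g \<in> ?S'" for g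
    proof -
      obtain e c where e: "e \<in> {1, - 1}" and g: "g = signed_shift n e c"
        using \<open>g \<in> ?S'\<close> by blast
      have ee: "e * e = 1"
        using e by auto
      have "inv\<^bsub>?B\<^esub> g = signed_shift n e (- (e * c))"
      proof (rule B.inv_equality)
        show "signed_shift n e (- (e * c)) \<otimes>\<^bsub>?B\<^esub> g = \<one>\<^bsub>?B\<^esub>"
          using signed_shift_mult[OF n(2) ee ee]
          by (simp add: g ee one_BijGroup_eq_signed_shift)
      qed (simp_all add: g n(2) ee signed_shift_in_BijGroup)
      with e show ?thesis
        by (intro CollectI exI conjI)
    qed
  qed
  moreover have "?T \<subseteq> ?S'"
    by (auto simp: right_translation_dihedral)
  ultimately show "carrier (Mlt_right {0..<n} (dihedral_quandle_op n)) \<subseteq> ?S"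
    unfolding carrier S_iff by (intro B.generate_subgroup_incl)
  have reflection: "signed_shift n (- 1) c \<in> generate ?B ?T" for c
  proof -
    let ?s = "((k + 1) * c) mod n"
    have "(2 * ?s) mod n = (2 * ((k + 1) * c)) mod n"
      by (simp add: mod_mult_right_eq)
    also have "2 * ((k + 1) * c) = c + n * c"
      by (simp add: n(1) algebra_simps)
    finally have "signed_shift n (- 1) c = signed_shift n (- 1) (2 * ?s)"
      by (metis mod_mult_self2 signed_shift_mod)
    then have "signed_shift n (- 1) c \<in> ?T"
      using n(2) by (intro image_eqI[of _ _ ?s]) (simp_all add: right_translation_dihedral)
    then show ?thesis
      by (rule generate.incl)
  qed
  have "signed_shift n 1 c \<in> generate ?B ?T" for c
    using generate.eng[OF reflection[of c] reflection[of 0]] n(2) by (simp add: signed_shift_mult)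
  with reflection show "?S \<subseteq> carrier (Mlt_right {0..<n} (dihedral_quandle_op n))"
    unfolding carrier S_iff by auto
qed

theorem theorem2p9:
  fixes k n :: int
  assumes "n = 2 * k + 1" and "n \<ge> 3"
  shows "Mlt_right {0..<n} (dihedral_quandle_op n) \<cong> dihedral_group (nat n)
    \<and> order (dihedral_group (nat n)) = 2 * nat n"
proof -
  let ?B = "BijGroup {0..<n}"
  let ?M = "Mlt_right {0..<n} (dihedral_quandle_op n)"
  let ?N = "{..<nat n} \<times> {..<2::nat}"
  let ?nf = "\<lambda>(i::nat, j::nat). signed_shift n 1 1 [^]\<^bsub>?B\<^esub> i
      \<otimes>\<^bsub>?B\<^esub> signed_shift n (- 1) 0 [^]\<^bsub>?B\<^esub> j"
  let ?S = "\<lambda>(i, j). signed_shift n ((- 1) ^ j) (int i)"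
  interpret B: group ?B by (rule group_BijGroup)
  have n: "n > 0" using assms by simp
  have nf: "?nf p = ?S p" if "p \<in> ?N" for p
    using that n signed_shift_normal_form by auto
  have rotation: "signed_shift n 1 1 [^]\<^bsub>?B\<^esub> nat n = \<one>\<^bsub>?B\<^esub>"
    using n signed_shift_mod[of n 1 n] signed_shift_pow_rotation[OF n, of "nat n"]
    by (simp add: one_BijGroup_eq_signed_shift)
  have "inj_on ?S ?N"
  proof (rule inj_onI, clarify)
    fix i j i' j' :: nat
    assume ij: "i < nat n" "j < 2" "i' < nat n" "j' < 2"
      and "signed_shift n ((- 1) ^ j) (int i) = signed_shift n ((- 1) ^ j') (int i')"
    then have "(- 1 :: int) ^ j = (- 1) ^ j' \<and> int i = int i'"
      using assms(2) by (intro signed_shift_inject[of n]) (auto simp: less_2_cases_iff)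
    then show "i = i' \<and> j = j'"
      using ij by (auto simp: less_2_cases_iff)
  qed
  moreover have "inj_on ?nf ?N \<longleftrightarrow> inj_on ?S ?N"
    by (rule inj_on_cong) (rule nf)
  ultimately have inj: "inj_on ?nf ?N" by (rule iffD2[rotated])
  have "?nf ` ?N = carrier ?M"
    unfolding carrier_Mlt_right_dihedral[OF assms(1) n] by (rule image_cong[OF HOL.refl]) (rule nf)
  then have M: "?B\<lparr>carrier := ?nf ` ?N\<rparr> = ?M"
    by (simp add: Mlt_right_def subgroup_generated_def)
  have nat_n: "nat n > 0" using n by simp
  have yy: "signed_shift n (- 1) 0 \<otimes>\<^bsub>?B\<^esub> signed_shift n (- 1) 0 = \<one>\<^bsub>?B\<^esub>"
    and xyxy: "signed_shift n 1 1 \<otimes>\<^bsub>?B\<^esub> (signed_shift n (- 1) 0 \<otimes>\<^bsub>?B\<^esub>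
      (signed_shift n 1 1 \<otimes>\<^bsub>?B\<^esub> signed_shift n (- 1) 0)) = \<one>\<^bsub>?B\<^esub>"
    using n by (simp_all add: signed_shift_mult one_BijGroup_eq_signed_shift)
  note D = B.dihedral_group_recognition[OF signed_shift_in_BijGroup signed_shift_in_BijGroup
      nat_n rotation yy xyxy inj, unfolded M]
  have "dihedral_group (nat n) \<cong> ?M"
    using n by (intro D(1)) simp_all
  moreover have "group (dihedral_group (nat n))"
    unfolding dihedral_group_def by (rule group_presented_group)
  ultimately show ?thesis
    using D(2) n group.iso_sym by simp
qed

end
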